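(* Let $V$ be a finite set with $n:=|V|$, and let $k$ be a positive integer. Let $\mathcal{F}\subseteq 2^V$ be the complement of a $k$-hierarchical lattice, and let $f:2^V\to\mathbb{Z}$ be a submodular function. Suppose that we are given an oracle for testing whether $X\in\mathcal{F}$ or not for any given $X\subseteq V$. Then a minimizer of $f$ over $\mathcal{F}$ can be obtained in $O(n^{2k}(\tau(n)+\gamma))$ time, where $\tau(n)$ denotes the time required for minimizing a submodular function on a ground set of size $n$, and $\gamma$ denotes the time required for one membership oracle query for $\mathcal{F}$.
   Context: A set function $f:2^V\to\mathbb{Z}$ is submodular if $f(X)+f(Y)\ge f(X\cup Y)+f(X\cap Y)$ for all $X,Y\subseteq V$. Submodular functions are accessed in the evaluation oracle model, i.e. through an oracle returning $f(X)$ for any given $X\subseteq V$. A family $\mathcal{H}\subseteq 2^V$ is a $k$-hierarchical lattice if there exists a chain of families $\emptyset=\mathcal{H}_0\subseteq\mathcal{H}_1\subseteq\cdots\subseteq\mathcal{H}_k=\mathcal{H}$ (where $\mathcal{H}_0$ is the empty family) such that for all $i=1,\ldots,k$ and all $X,Y\in\mathcal{H}_i\setminus\mathcal{H}_{i-1}$, either both $X\cup Y$ and $X\cap Y$ belong to $\mathcal{H}_i\setminus\mathcal{H}_{i-1}$, or at least one of $X\cup Y$, $X\cap Y$ belongs to $\mathcal{H}_{i-1}$. A family $\mathcal{F}\subseteq 2^V$ is the complement of a $k$-hierarchical lattice if $2^V\setminus\mathcal{F}$ is a $k$-hierarchical lattice. A minimizer of $f$ over a family $\mathcal{G}\subseteq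 2^V$ is a set $X\in\mathcal{G}$ with $f(X)\le f(Y)$ for all $Y\in\mathcal{G}$; the algorithm is required to output one whenever $\mathcal{G}$ is nonempty. *)

theory Defs
  imports Main
begin

definition submodular_on :: "'a set \<Rightarrow> ('a set \<Rightarrow> int) \<Rightarrow> bool" where
  "submodular_on V f \<longleftrightarrow>
     (\<forall>X Y. X \<subseteq> V \<longrightarrow> Y \<subseteq> V \<longrightarrow> f X + f Y \<ge> f (X \<union> Y) + f (X \<inter> Y))"

definition hierarchical_lattice :: "nat \<Rightarrow> 'a set \<Rightarrow> 'a set set \<Rightarrow> bool" where
  "hierarchical_lattice k V \<H> \<longleftrightarrow>
     \<H> \<subseteq> Pow V \<and>
     (\<exists>H :: nat \<Rightarrow> 'a set set. H 0 = {} \<and> H k = \<H> \<and>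
        (\<forall>i\<in>{1..k}. H (i - 1) \<subseteq> H i \<and>
           (\<forall>X \<in> H i - H (i - 1). \<forall>Y \<in> H i - H (i - 1).
              (X \<union> Y \<in> H i - H (i - 1) \<and> X \<inter> Y \<in> H i - H (i - 1)) \<or>
              X \<union> Y \<in> H (i - 1) \<or> X \<inter> Y \<in> H (i - 1))))"

definition complement_hierarchical :: "nat \<Rightarrow> 'a set \<Rightarrow> 'a set set \<Rightarrow> bool" where
  "complement_hierarchical k V \<F> \<longleftrightarrow> \<F> \<subseteq> Pow V \<and> hierarchical_lattice k V (Pow V - \<F>)"

definition is_minimizer :: "('a set \<Rightarrow> int) \<Rightarrow> 'a set set \<Rightarrow> 'a set \<Rightarrow> bool" where
  "is_minimizer f \<G> X \<longleftrightarrow> X \<in> \<G> \<and> (\<forall>Y\<in>\<G>. f X \<le> f Y)"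

text \<open>
  Running time is measured on a random access machine with oracles.  The ground set is
  \<open>{..<n}\<close>.  The machine has an integer memory, with direct and indirect access, addition and
  subtraction, and a second memory whose cells hold subsets of the ground set stored as bit
  vectors.  A bit vector can be changed or tested only one bit at a time; there is no operation
  that copies, unites or compares whole sets.  \<open>Swap\<close> exchanges two set cells (an exchange of
  pointers) and gives indirect access to the set memory.  Negative integers used as addresses or
  as elements count as \<open>0\<close>.

  Positions \<open>\<ge> n\<close> of a bit vector may be written, but every oracle, and whoever reads the result
  of a program, looks at the first \<open>n\<close> bits only.

  \<open>Eval x s\<close> asks the evaluation oracle for the value of set cell \<open>s\<close>, \<open>Query x s\<close> asks the
  membership oracle whether set cell \<open>s\<close> is in the family, and both store the answer in memory
  cell \<open>x\<close>.

  \<open>Call P es s\<close> runs \<open>P\<close> as a subroutine, in a fresh memory, on the set function obtained from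
  the current one by first making the bit changes \<open>es\<close> to its argument, and puts the set returned
  by \<open>P\<close> into cell \<open>s\<close>.
\<close>

datatype bit_change = Put nat | Drop nat

datatype guard = Less nat nat | Elem nat nat

datatype com =
    Skip
  | Const nat int
  | Add nat nat nat
  | Sub nat nat nat
  | Load nat nat
  | Store nat nat
  | Insert nat nat
  | Delete nat nat
  | Swap nat nat
  | Eval nat nat
  | Query nat nat
  | Call com "bit_change list" nat
  | Seq com com
  | Branch guard com com
  | While guard com

type_synonym state = "(nat \<Rightarrow> int) \<times> (nat \<Rightarrow> nat set)"

fun change :: "(nat \<Rightarrow> int) \<Rightarrow> bit_change \<Rightarrow> nat set \<Rightarrow> nat set" where
  "change M (Put x) X = insert (nat (M x)) X"
| "change M (Drop x) X = X - {nat (M x)}"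

fun holds :: "guard \<Rightarrow> state \<Rightarrow> bool" where
  "holds (Less x y) (M, S) \<longleftrightarrow> M x < M y"
| "holds (Elem x s) (M, S) \<longleftrightarrow> nat (M x) \<in> S s"

definition start :: "nat \<Rightarrow> state" where
  "start n = ((\<lambda>_. 0)(0 := int n), (\<lambda>_. {}))"

definition result :: "nat \<Rightarrow> state \<Rightarrow> nat set" where
  "result n \<sigma> = snd \<sigma> 0 \<inter> {..<n}"

text \<open>
  \<open>exec n \<F> \<gamma> f q c \<sigma> t \<sigma>'\<close>: with ground set \<open>{..<n}\<close>, membership oracle \<open>\<F>\<close> at \<open>\<gamma>\<close> time units
  per query and evaluation oracle \<open>f\<close> at \<open>q\<close> time units per evaluation, \<open>c\<close> started in \<open>\<sigma>\<close>
  terminates in \<open>\<sigma>'\<close> after \<open>t\<close> time units.  Inside \<open>Call P es s\<close>, answering one evaluation by \<open>P\<close>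
  takes one evaluation by the caller and up to \<open>2 * length es\<close> further steps, to make the changes
  \<open>es\<close> and to undo them.
\<close>

inductive exec ::
  "nat \<Rightarrow> nat set set \<Rightarrow> nat \<Rightarrow> (nat set \<Rightarrow> int) \<Rightarrow> nat \<Rightarrow> com \<Rightarrow> state \<Rightarrow> nat \<Rightarrow> state \<Rightarrow> bool"
  for n :: nat and \<F> :: "nat set set" and \<gamma> :: nat
where
  Skip: "exec n \<F> \<gamma> f q Skip \<sigma> 1 \<sigma>"
| Const: "exec n \<F> \<gamma> f q (Const x c) (M, S) 1 (M(x := c), S)"
| Add: "exec n \<F> \<gamma> f q (Add x y z) (M, S) 1 (M(x := M y + M z), S)"
| Sub: "exec n \<F> \<gamma> f q (Sub x y z) (M, S) 1 (M(x := M y - M z), S)"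
| Load: "exec n \<F> \<gamma> f q (Load x y) (M, S) 1 (M(x := M (nat (M y))), S)"
| Store: "exec n \<F> \<gamma> f q (Store x y) (M, S) 1 (M(nat (M x) := M y), S)"
| Insert: "exec n \<F> \<gamma> f q (Insert x s) (M, S) 1 (M, S(s := insert (nat (M x)) (S s)))"
| Delete: "exec n \<F> \<gamma> f q (Delete x s) (M, S) 1 (M, S(s := S s - {nat (M x)}))"
| Swap: "exec n \<F> \<gamma> f q (Swap x y) (M, S) 1
           (M, S(nat (M x) := S (nat (M y)), nat (M y) := S (nat (M x))))"
| Eval: "exec n \<F> \<gamma> f q (Eval x s) (M, S) q (M(x := f (S s \<inter> {..<n})), S)"
| Query: "exec n \<F> \<gamma> f q (Query x s) (M, S) \<gamma>
            (M(x := (if S s \<inter> {..<n} \<in> \<F> then 1 else 0)), S)"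
| Call: "exec n \<F> \<gamma> (\<lambda>X. f (fold (change M) es X \<inter> {..<n})) (2 * length es + q) P (start n) t \<sigma> \<Longrightarrow>
         exec n \<F> \<gamma> f q (Call P es s) (M, S) (t + 1) (M, S(s := result n \<sigma>))"
| Seq: "exec n \<F> \<gamma> f q c \<sigma> t \<sigma>' \<Longrightarrow> exec n \<F> \<gamma> f q d \<sigma>' u \<sigma>'' \<Longrightarrow>
        exec n \<F> \<gamma> f q (Seq c d) \<sigma> (t + u) \<sigma>''"
| BranchTrue: "holds b \<sigma> \<Longrightarrow> exec n \<F> \<gamma> f q c \<sigma> t \<sigma>' \<Longrightarrow>
        exec n \<F> \<gamma> f q (Branch b c d) \<sigma> (t + 1) \<sigma>'"
| BranchFalse: "\<not> holds b \<sigma> \<Longrightarrow> exec n \<F> \<gamma> f q d \<sigma> t \<sigma>' \<Longrightarrow>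
        exec n \<F> \<gamma> f q (Branch b c d) \<sigma> (t + 1) \<sigma>'"
| WhileFalse: "\<not> holds b \<sigma> \<Longrightarrow> exec n \<F> \<gamma> f q (While b c) \<sigma> 1 \<sigma>"
| WhileTrue: "holds b \<sigma> \<Longrightarrow> exec n \<F> \<gamma> f q c \<sigma> t \<sigma>' \<Longrightarrow>
        exec n \<F> \<gamma> f q (While b c) \<sigma>' u \<sigma>'' \<Longrightarrow>
        exec n \<F> \<gamma> f q (While b c) \<sigma> (t + u + 1) \<sigma>''"

text \<open>
  The machine is deterministic, so the existence of a terminating run with a given duration and
  result is a statement about the only run.
\<close>

inductive_cases execE:
  "exec n \<F> \<gamma> f q (Call P es s) \<sigma> t \<sigma>'"
  "exec n \<F> \<gamma> f q (Seq c d) \<sigma> t \<sigma>'"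
  "exec n \<F> \<gamma> f q (Branch b c d) \<sigma> t \<sigma>'"
  "exec n \<F> \<gamma> f q (While b c) \<sigma> t \<sigma>'"

lemma exec_deterministic:
  "exec n \<F> \<gamma> f q c \<sigma> t \<sigma>' \<Longrightarrow> exec n \<F> \<gamma> f q c \<sigma> v \<rho> \<Longrightarrow> v = t \<and> \<rho> = \<sigma>'"
proof (induction arbitrary: v \<rho> rule: exec.induct)
  case (Call f M es q P t \<sigma> s S)
  from Call.prems show ?case
    by (rule execE(1)) (use Call.IH in force)
next
  case (Seq f q c \<sigma> t \<sigma>' d u \<sigma>'')
  from Seq.prems show ?case
    by (rule execE(2)) (metis Seq.IH)
next
  case (BranchTrue b \<sigma> f q c t \<sigma>' d)
  from BranchTrue.prems show ?case
    by (rule execE(3)) (metis BranchTrue.hyps BranchTrue.IH Suc_eq_plus1 add.commute One_nat_def)+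
next
  case (BranchFalse b \<sigma> f q d t \<sigma>' c)
  from BranchFalse.prems show ?case
    by (rule execE(3)) (metis BranchFalse.hyps BranchFalse.IH Suc_eq_plus1 add.commute One_nat_def)+
next
  case (WhileFalse b \<sigma> f q c)
  from WhileFalse.prems show ?case
    by (rule execE(4)) (metis WhileFalse.hyps Suc_eq_plus1 add.commute One_nat_def)+
next
  case (WhileTrue b \<sigma> f q c t \<sigma>' u \<sigma>'')
  from WhileTrue.prems show ?case
    by (rule execE(4)) (metis WhileTrue.hyps WhileTrue.IH Suc_eq_plus1 add.commute One_nat_def)+
qed (erule exec.cases; auto; fail)+

primrec query_free :: "com \<Rightarrow> bool" where
  "query_free Skip = True"
| "query_free (Const x c) = True"
| "query_free (Add x y z) = True"
| "query_free (Sub x y z) = True"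
| "query_free (Load x y) = True"
| "query_free (Store x y) = True"
| "query_free (Insert x s) = True"
| "query_free (Delete x s) = True"
| "query_free (Swap x y) = True"
| "query_free (Eval x s) = True"
| "query_free (Query x s) = False"
| "query_free (Call P es s) = query_free P"
| "query_free (Seq c d) = (query_free c \<and> query_free d)"
| "query_free (Branch b c d) = (query_free c \<and> query_free d)"
| "query_free (While b c) = query_free c"

text \<open>
  At the top level an evaluation of \<open>f\<close> counts as one time unit.  Submodular function
  minimization uses no membership oracle, so that \<open>{}\<close> and \<open>0\<close> below are dummies.
\<close>

definition minimizes_submodular :: "com \<Rightarrow> (nat \<Rightarrow> nat) \<Rightarrow> bool" where
  "minimizes_submodular P \<tau> \<longleftrightarrow> query_free P \<and>
     (\<forall>n f. submodular_on {..<n} f \<longrightarrow>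
        (\<exists>t \<sigma>. exec n {} 0 f 1 P (start n) t \<sigma> \<and> t \<le> \<tau> n \<and>
               is_minimizer f (Pow {..<n}) (result n \<sigma>)))"

end

theory Submission
  imports Defs
begin

text \<open>
  A set \<open>X\<close> outside a lattice of sets is separated from it by two elements: if every \<open>s \<in> X\<close> and
  \<open>t \<notin> X\<close> had a lattice member containing \<open>s\<close> but not \<open>t\<close>, then \<open>X\<close> would be a union of
  intersections of such members.  Applying this once per level of a \<open>k\<close>-hierarchical lattice, inside
  the interval that avoids the previous level, gives \<open>A \<subseteq> X\<close> and \<open>B\<close> disjoint from \<open>X\<close>, of size at
  most \<open>k\<close> each, such that the interval \<open>[A, V - B]\<close> avoids the whole hierarchical lattice.  So
  minimizing \<open>f\<close> over each of the \<open>O(n\<^sup>2\<^sup>k)\<close> intervals of this kind and keeping the best minimizer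
  that passes the membership query yields a minimizer over the complement.
\<close>

section \<open>Intervals avoiding a hierarchical lattice\<close>

text \<open>Bounding the cardinalities by 1 instead of asking for singletons covers
  \<open>X = {}\<close> and \<open>X = V\<close>, where one of the two separating elements does not
  exist.\<close>

lemma lattice_separation:
  assumes "finite V" "L \<subseteq> Pow V" "X \<subseteq> V" "X \<notin> L"
    and Un: "\<And>Y Z. Y \<in> L \<Longrightarrow> Z \<in> L \<Longrightarrow> Y \<union> Z \<in> L"
    and Int: "\<And>Y Z. Y \<in> L \<Longrightarrow> Z \<in> L \<Longrightarrow> Y \<inter> Z \<in> L"
  obtains A B where "A \<subseteq> X" "B \<subseteq> V - X" "card A \<le> 1" "card B \<le> 1"
    "\<And>Z. Z \<in> L \<Longrightarrow> A \<subseteq> Z \<Longrightarrow> Z \<inter> B \<noteq> {}"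
proof (rule ccontr)
  note separating = that
  assume no: "\<not> thesis"
  then have sep: "\<exists>Z\<in>L. A \<subseteq> Z \<and> Z \<inter> B = {}"
    if "A \<subseteq> X" "B \<subseteq> V - X" "card A \<le> 1" "card B \<le> 1" for A B
    using separating[OF that] no by meson
  \<comment> \<open>Intersecting members that each miss one element of \<open>B\<close> gives a
    member missing all of \<open>B\<close>.\<close>
  have sepB: "\<exists>Z\<in>L. A \<subseteq> Z \<and> Z \<inter> B = {}"
    if A: "A \<subseteq> X" "card A \<le> 1" and "finite B" "B \<subseteq> V - X" for A B
    using that(3,4)
  proof (induction B)
    case empty
    show ?case using sep[of A "{}"] A by simp
  next
    case (insert t B)
    then obtain Y where "Y \<in> L" "A \<subseteq> Y" "Y \<inter> B = {}" by auto
    moreover obtain Z where "Z \<in> L" "A \<subseteq> Z" "Z \<inter> {t} = {}"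
      using sep[of A "{t}"] A insert.prems by auto
    ultimately show ?case using Int by (intro bexI[of _ "Y \<inter> Z"]) auto
  qed
  \<comment> \<open>Dually, with \<open>V - X\<close> as the forbidden set, the members found for
    single elements are united; for \<open>A = X\<close> the union can only be
    \<open>X\<close>.\<close>
  have sepA: "\<exists>Z\<in>L. A \<subseteq> Z \<and> Z \<inter> (V - X) = {}" if "finite A" "A \<subseteq> X" for A
    using that
  proof (induction A)
    case empty
    show ?case using sepB[of "{}" "V - X"] \<open>finite V\<close> by simp
  next
    case (insert s A)
    then obtain Y where "Y \<in> L" "A \<subseteq> Y" "Y \<inter> (V - X) = {}" by auto
    moreover obtain Z where "Z \<in> L" "{s} \<subseteq> Z" "Z \<inter> (V - X) = {}"
      using sepB[of "{s}" "V - X"] insert.prems \<open>finite V\<close> by auto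
    ultimately show ?case using Un by (intro bexI[of _ "Y \<union> Z"]) auto
  qed
  obtain Z where "Z \<in> L" "X \<subseteq> Z" "Z \<inter> (V - X) = {}"
    using sepA[of X] \<open>finite V\<close> \<open>X \<subseteq> V\<close> finite_subset by blast
  then have "Z = X" using \<open>L \<subseteq> Pow V\<close> by auto
  with \<open>Z \<in> L\<close> \<open>X \<notin> L\<close> show False by simp
qed

text \<open>\<open>A\<close> is cut down to \<open>V\<close>, and elements of \<open>B\<close>
  outside \<open>V\<close> have no effect, so both sets may carry padding from outside the ground
  set.\<close>

definition interval :: "'a set \<Rightarrow> 'a set \<Rightarrow> 'a set \<Rightarrow> 'a set set" where
  "interval V A B = {Z. Z \<subseteq> V \<and> A \<inter> V \<subseteq> Z \<and> Z \<inter> B = {}}"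

lemma hierarchical_lattice_separation:
  assumes "finite V" "hierarchical_lattice k V \<H>" "X \<subseteq> V" "X \<notin> \<H>"
  obtains A B where "A \<subseteq> X" "B \<subseteq> V - X" "card A \<le> k" "card B \<le> k" "interval V A B \<inter> \<H> = {}"
proof -
  from assms(2) obtain H where H: "H 0 = {}" "H k = \<H>"
    and mono: "\<And>i. i \<in> {1..k} \<Longrightarrow> H (i - 1) \<subseteq> H i"
    and lat: "\<And>i X Y. i \<in> {1..k} \<Longrightarrow> X \<in> H i - H (i - 1) \<Longrightarrow> Y \<in> H i - H (i - 1) \<Longrightarrow>
       (X \<union> Y \<in> H i - H (i - 1) \<and> X \<inter> Y \<in> H i - H (i - 1)) \<or>
              X \<union> Y \<in> H (i - 1) \<or> X \<inter> Y \<in> H (i - 1)"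
    unfolding hierarchical_lattice_def by blast
  have sub: "H j \<subseteq> H k" if "j \<le> k" for j
    using that
  proof (induction rule: inc_induct)
    case (step i)
    then show ?case using mono[of "Suc i"] by auto
  qed simp
  have "\<exists>A B. A \<subseteq> X \<and> B \<subseteq> V - X \<and> card A \<le> j \<and> card B \<le> j \<and> interval V A B \<inter> H j = {}"
    if "j \<le> k" for j
    using that
  proof (induction j)
    case 0
    show ?case by (intro exI[of _ "{}"]) (simp add: H)
  next
    case (Suc j)
    then obtain A B where AB: "A \<subseteq> X" "B \<subseteq> V - X" "card A \<le> j" "card B \<le> j"
      and avoid: "interval V A B \<inter> H j = {}" by auto
    define L where "L = interval V A B \<inter> H (Suc j)"
    \<comment> \<open>The interval avoids \<open>H j\<close>, so \<open>L\<close> lies in the layer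
      \<open>H (Suc j) - H j\<close>. Unions and intersections stay in the interval, which rules out
      the alternative that one of them falls into \<open>H j\<close>.\<close>
    have closed: "Y \<union> Z \<in> L \<and> Y \<inter> Z \<in> L" if "Y \<in> L" "Z \<in> L" for Y Z
    proof -
      have "Y \<union> Z \<in> interval V A B" "Y \<inter> Z \<in> interval V A B"
        using that by (auto simp: L_def interval_def)
      moreover have "Y \<in> H (Suc j) - H j" "Z \<in> H (Suc j) - H j"
        using that avoid by (auto simp: L_def)
      ultimately show ?thesis
        using lat[of "Suc j" Y Z] Suc.prems avoid by (auto simp: L_def)
    qed
    have "X \<notin> L" using sub[of "Suc j"] Suc.prems H assms(4) by (auto simp: L_def)
    moreover have "L \<subseteq> Pow V" by (auto simp: L_def interval_def)
    ultimately obtain A' B' where AB': "A' \<subseteq> X" "B' \<subseteq> V - X" "card A' \<le> 1" "card B' \<le> 1"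
      and sep: "\<And>Z. Z \<in> L \<Longrightarrow> A' \<subseteq> Z \<Longrightarrow> Z \<inter> B' \<noteq> {}"
      using lattice_separation[OF assms(1) _ assms(3), of L] closed by metis
    have "card (A \<union> A') \<le> Suc j" "card (B \<union> B') \<le> Suc j"
      using card_Un_le[of A A'] card_Un_le[of B B'] AB AB' by linarith+
    moreover have "interval V (A \<union> A') (B \<union> B') \<inter> H (Suc j) = {}"
    proof (rule ccontr)
      assume "interval V (A \<union> A') (B \<union> B') \<inter> H (Suc j) \<noteq> {}"
      then obtain Z where "Z \<in> interval V (A \<union> A') (B \<union> B')" "Z \<in> H (Suc j)" by blast
      moreover from this have "Z \<in> L" by (auto simp: L_def interval_def)
      ultimately show False using sep[of Z] AB' assms(3) unfolding interval_def by blast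
    qed
    ultimately show ?case using AB AB' by (intro exI[of _ "A \<union> A'"] exI[of _ "B \<union> B'"]) blast
  qed
  from this[of k] show thesis using that H by auto
qed

text \<open>\<open>n\<close> is outside the ground set, so repeating it fills the slots left over
  when \<open>A\<close> has fewer than \<open>k\<close> elements.\<close>

lemma ex_enumeration_with_padding:
  assumes "A \<subseteq> {..<n}" "card A \<le> k"
  obtains w :: "nat \<Rightarrow> nat" where "\<And>i. w i \<le> n" "w ` {..<k} \<inter> {..<n} = A"
proof -
  have "finite A" using assms(1) finite_subset by blast
  then obtain h where h: "bij_betw h {0..<card A} A" using ex_bij_betw_nat_finite by blast
  define w where "w i = (if i < card A then h i else n)" for i
  have hA: "h ` {0..<card A} = A" using h by (simp add: bij_betw_def)
  have "w i \<le> n" for i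
  proof (cases "i < card A")
    case True
    then have "h i \<in> A" using hA by auto
    with True assms(1) show ?thesis by (auto simp: w_def)
  qed (simp add: w_def)
  moreover have "w ` {..<k} \<inter> {..<n} = A"
  proof
    show "w ` {..<k} \<inter> {..<n} \<subseteq> A" using hA by (auto simp: w_def)
    show "A \<subseteq> w ` {..<k} \<inter> {..<n}"
    proof
      fix a assume "a \<in> A"
      then obtain i where "i < card A" "a = h i" using hA by (metis atLeastLessThan_iff imageE)
      then show "a \<in> w ` {..<k} \<inter> {..<n}"
        using assms \<open>a \<in> A\<close> by (auto simp: w_def image_iff intro!: bexI[of _ i])
    qed
  qed
  ultimately show thesis by (rule that)
qed

section \<open>Timed total correctness\<close>

text \<open>Only \<open>Query\<close> depends on the membership oracle, and only evaluations change
  in price, so the same run exists and is at most \<open>m\<close> times as long. This transfers a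
  bound for unit-cost evaluations to a subroutine whose evaluations are dearer.\<close>

lemma exec_rescale:
  assumes "exec n \<F> \<gamma> f q c \<sigma> t \<sigma>'" "query_free c" "q' \<le> m * q" "m \<ge> 1"
  shows "\<exists>t'. t' \<le> m * t \<and> exec n \<F>' \<gamma>' f q' c \<sigma> t' \<sigma>'"
  using assms
proof (induction arbitrary: q' rule: exec.induct)
  case (Call f M es q P t \<sigma> s S)
  have "2 * length es + q' \<le> m * (2 * length es + q)"
    unfolding distrib_left using Call.prems mult_le_mono1[of 1 m "2 * length es"]
    by (intro add_mono) simp_all
  with Call.IH[of "2 * length es + q'"] Call.prems obtain t' where "t' \<le> m * t"
    "exec n \<F>' \<gamma>' (\<lambda>X. f (fold (change M) es X \<inter> {..<n})) (2 * length es + q') P (start n) t' \<sigma>"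
    by auto
  then show ?case using exec.Call[of n \<F>' \<gamma>' f M es q' P t' \<sigma> s S] Call.prems
    by (intro exI[of _ "t' + 1"]) auto
next
  case (Seq f q c \<sigma> t \<sigma>' d u \<sigma>'')
  then obtain t' u' where "t' \<le> m * t" "exec n \<F>' \<gamma>' f q' c \<sigma> t' \<sigma>'"
    "u' \<le> m * u" "exec n \<F>' \<gamma>' f q' d \<sigma>' u' \<sigma>''" by fastforce
  then show ?case
    by (intro exI[of _ "t' + u'"]) (auto simp: distrib_left intro: exec.Seq)
next
  case (BranchTrue b \<sigma> f q c t \<sigma>' d)
  then obtain t' where "t' \<le> m * t" "exec n \<F>' \<gamma>' f q' c \<sigma> t' \<sigma>'" by fastforce
  moreover from this have "t' + 1 \<le> m * (t + 1)"
    using \<open>m \<ge> 1\<close> by (simp add: distrib_left)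
  ultimately show ?case using exec.BranchTrue BranchTrue.hyps by blast
next
  case (BranchFalse b \<sigma> f q d t \<sigma>' c)
  then obtain t' where "t' \<le> m * t" "exec n \<F>' \<gamma>' f q' d \<sigma> t' \<sigma>'" by fastforce
  moreover from this have "t' + 1 \<le> m * (t + 1)"
    using \<open>m \<ge> 1\<close> by (simp add: distrib_left)
  ultimately show ?case using exec.BranchFalse BranchFalse.hyps by blast
next
  case (WhileTrue b \<sigma> f q c t \<sigma>' u \<sigma>'')
  then obtain t' u' where "t' \<le> m * t" "exec n \<F>' \<gamma>' f q' c \<sigma> t' \<sigma>'"
    "u' \<le> m * u" "exec n \<F>' \<gamma>' f q' (While b c) \<sigma>' u' \<sigma>''" by fastforce
  moreover from this have "t' + u' + 1 \<le> m * (t + u + 1)"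
    using \<open>m \<ge> 1\<close> by (simp add: distrib_left)
  ultimately show ?case using exec.WhileTrue WhileTrue.hyps by blast
qed (auto simp del: One_nat_def intro: exec.intros(1-10) exec.WhileFalse)

lemma exec_time_pos:
  assumes "exec n \<F> \<gamma> f q c \<sigma> t \<sigma>'" "query_free c" "q \<ge> 1"
  shows "t \<ge> 1"
  using assms by (induction rule: exec.induct) auto

text \<open>An upper bound \<open>T\<close> in place of the exact duration lets branches of
  different lengths be joined.\<close>

definition terminates ::
  "nat \<Rightarrow> nat set set \<Rightarrow> nat \<Rightarrow> (nat set \<Rightarrow> int) \<Rightarrow> nat \<Rightarrow> com \<Rightarrow> state \<Rightarrow> nat \<Rightarrow> (state \<Rightarrow> bool) \<Rightarrow> bool"
where
  "terminates n \<F> \<gamma> f q c \<sigma> T Q \<longleftrightarrow> (\<exists>t \<sigma>'. exec n \<F> \<gamma> f q c \<sigma> t \<sigma>' \<and> t \<le> T \<and> Q \<sigma>')"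

lemma terminates_mono:
  "terminates n \<F> \<gamma> f q c \<sigma> T Q \<Longrightarrow> T \<le> T' \<Longrightarrow> (\<And>\<sigma>'. Q \<sigma>' \<Longrightarrow> Q' \<sigma>') \<Longrightarrow>
   terminates n \<F> \<gamma> f q c \<sigma> T' Q'"
  unfolding terminates_def using le_trans by blast

lemma terminates_Seq:
  assumes "terminates n \<F> \<gamma> f q c \<sigma> T R" "\<And>\<sigma>'. R \<sigma>' \<Longrightarrow> terminates n \<F> \<gamma> f q d \<sigma>' U Q"
  shows "terminates n \<F> \<gamma> f q (Seq c d) \<sigma> (T + U) Q"
proof -
  obtain t \<sigma>' where c: "exec n \<F> \<gamma> f q c \<sigma> t \<sigma>'" "t \<le> T" "R \<sigma>'"
    using assms(1) by (auto simp: terminates_def)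
  then obtain u \<sigma>'' where "exec n \<F> \<gamma> f q d \<sigma>' u \<sigma>''" "u \<le> U" "Q \<sigma>''"
    using assms(2) unfolding terminates_def by blast
  with c show ?thesis unfolding terminates_def by (meson add_mono exec.Seq)
qed

lemma terminates_Branch:
  assumes "holds b \<sigma> \<Longrightarrow> terminates n \<F> \<gamma> f q c \<sigma> T Q"
    and "\<not> holds b \<sigma> \<Longrightarrow> terminates n \<F> \<gamma> f q d \<sigma> T Q"
  shows "terminates n \<F> \<gamma> f q (Branch b c d) \<sigma> (T + 1) Q"
  using assms unfolding terminates_def
  by (cases "holds b \<sigma>") (meson add_le_mono1 exec.BranchTrue exec.BranchFalse)+

text \<open>The invariant is indexed by the number of completed passes, exactly \<open>m\<close> in
  total. Each pass pays one unit for its test; the final failing test is the last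
  \<open>+ 1\<close>.\<close>

lemma terminates_While:
  assumes "\<And>i \<sigma>. i < m \<Longrightarrow> Inv i \<sigma> \<Longrightarrow> holds b \<sigma> \<and> terminates n \<F> \<gamma> f q c \<sigma> T (Inv (Suc i))"
    and "\<And>\<sigma>. Inv m \<sigma> \<Longrightarrow> \<not> holds b \<sigma>"
    and "Inv 0 \<sigma>"
  shows "terminates n \<F> \<gamma> f q (While b c) \<sigma> (m * (T + 1) + 1) (Inv m)"
proof -
  have "terminates n \<F> \<gamma> f q (While b c) \<sigma> ((m - i) * (T + 1) + 1) (Inv m)"
    if "i \<le> m" "Inv i \<sigma>" for i \<sigma>
    using that
  proof (induction arbitrary: \<sigma> rule: inc_induct)
    case base
    then have "exec n \<F> \<gamma> f q (While b c) \<sigma> 1 \<sigma>" using assms(2) exec.WhileFalse by blast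
    with base show ?case unfolding terminates_def by (intro exI[of _ 1] exI[of _ \<sigma>]) simp
  next
    case (step i)
    then obtain t \<sigma>' where "holds b \<sigma>" "exec n \<F> \<gamma> f q c \<sigma> t \<sigma>'" "t \<le> T" "Inv (Suc i) \<sigma>'"
      using assms(1) unfolding terminates_def by blast
    moreover from step.IH[OF this(4)] obtain u \<sigma>'' where
      "exec n \<F> \<gamma> f q (While b c) \<sigma>' u \<sigma>''" "u \<le> (m - Suc i) * (T + 1) + 1" "Inv m \<sigma>''"
      unfolding terminates_def by blast
    moreover have "m - i = Suc (m - Suc i)" using step.hyps by simp
    ultimately show ?case unfolding terminates_def
      by (intro exI[of _ "t + u + 1"] exI[of _ \<sigma>'']) (auto intro: exec.WhileTrue[simplified])
  qed
  from this[of 0] assms(3) show ?thesis by simp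
qed

lemma terminates_atomic:
  "Q \<sigma> \<Longrightarrow> terminates n \<F> \<gamma> f q Skip \<sigma> 1 Q"
  "Q (M(x := c), S) \<Longrightarrow> terminates n \<F> \<gamma> f q (Const x c) (M, S) 1 Q"
  "Q (M(x := M y + M z), S) \<Longrightarrow> terminates n \<F> \<gamma> f q (Add x y z) (M, S) 1 Q"
  "Q (M, S(nat (M x) := S (nat (M y)), nat (M y) := S (nat (M x)))) \<Longrightarrow>
     terminates n \<F> \<gamma> f q (Swap x y) (M, S) 1 Q"
  "Q (M(x := f (S s \<inter> {..<n})), S) \<Longrightarrow> terminates n \<F> \<gamma> f q (Eval x s) (M, S) q Q"
  "Q (M(x := (if S s \<inter> {..<n} \<in> \<F> then 1 else 0)), S) \<Longrightarrow>
     terminates n \<F> \<gamma> f q (Query x s) (M, S) \<gamma> Q"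
  unfolding terminates_def by (meson exec.intros order_refl)+

lemma terminates_Seq_atomic:
  assumes "terminates n \<F> \<gamma> f q d (M', S') T Q"
  shows
    "M' = M(x := c) \<Longrightarrow> S' = S \<Longrightarrow>
       terminates n \<F> \<gamma> f q (Seq (Const x c) d) (M, S) (1 + T) Q"
    "M' = M(x := M y + M z) \<Longrightarrow> S' = S \<Longrightarrow>
       terminates n \<F> \<gamma> f q (Seq (Add x y z) d) (M, S) (1 + T) Q"
    "M' = M \<Longrightarrow> S' = S(nat (M x) := S (nat (M y)), nat (M y) := S (nat (M x))) \<Longrightarrow>
       terminates n \<F> \<gamma> f q (Seq (Swap x y) d) (M, S) (1 + T) Q"
    "M' = M(x := f (S s \<inter> {..<n})) \<Longrightarrow> S' = S \<Longrightarrow>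
       terminates n \<F> \<gamma> f q (Seq (Eval x s) d) (M, S) (q + T) Q"
    "M' = M(x := (if S s \<inter> {..<n} \<in> \<F> then 1 else 0)) \<Longrightarrow> S' = S \<Longrightarrow>
       terminates n \<F> \<gamma> f q (Seq (Query x s) d) (M, S) (\<gamma> + T) Q"
  using assms
  by (auto intro!: terminates_Seq[where R = "\<lambda>\<sigma>. \<sigma> = (M', S')"] terminates_atomic
      simp del: One_nat_def)

lemma terminates_Call:
  assumes "terminates n \<F> \<gamma> (\<lambda>X. f (fold (change M) es X \<inter> {..<n})) (2 * length es + q) P (start n) T
             (\<lambda>\<sigma>. Q (M, S(s := result n \<sigma>)))"
  shows "terminates n \<F> \<gamma> f q (Call P es s) (M, S) (T + 1) Q"
proof -
  obtain t \<sigma> where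
    "exec n \<F> \<gamma> (\<lambda>X. f (fold (change M) es X \<inter> {..<n})) (2 * length es + q) P (start n) t \<sigma>"
    "t \<le> T" "Q (M, S(s := result n \<sigma>))"
    using assms unfolding terminates_def by blast
  then show ?thesis unfolding terminates_def
    by (intro exI[of _ "t + 1"] exI[of _ "(M, S(s := result n \<sigma>))"] conjI exec.Call) auto
qed

section \<open>The submodular minimization subroutine\<close>

lemma terminates_minimization:
  assumes "minimizes_submodular P \<tau>" "submodular_on {..<n} g" "q \<ge> 1"
  shows "terminates n \<F> \<gamma> g q P (start n) (q * \<tau> n) (\<lambda>\<sigma>. is_minimizer g (Pow {..<n}) (result n \<sigma>))"
proof -
  obtain t \<sigma> where t: "exec n {} 0 g 1 P (start n) t \<sigma>" "t \<le> \<tau> n"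
    "is_minimizer g (Pow {..<n}) (result n \<sigma>)"
    using assms(1,2) unfolding minimizes_submodular_def by blast
  moreover obtain t' where "t' \<le> q * t" "exec n \<F> \<gamma> g q P (start n) t' \<sigma>"
    using exec_rescale[OF t(1), of q q \<F> \<gamma>] assms(1,3) unfolding minimizes_submodular_def by auto
  moreover have "q * t \<le> q * \<tau> n" using t(2) by simp
  ultimately show ?thesis unfolding terminates_def using le_trans by blast
qed

text \<open>A run on the zero function already takes a step. The bound lets additive constants be
  absorbed into multiples of \<open>\<tau> n\<close>.\<close>

lemma minimization_time_pos:
  assumes "minimizes_submodular P \<tau>"
  shows "\<tau> n \<ge> 1"
proof -
  have "submodular_on {..<n} (\<lambda>_. 0)" by (simp add: submodular_on_def)
  then obtain t \<sigma> where "exec n {} 0 (\<lambda>_. 0) 1 P (start n) t \<sigma>" "t \<le> \<tau> n"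
    using assms unfolding minimizes_submodular_def by blast
  moreover from this(1) have "t \<ge> 1"
    using exec_time_pos assms by (auto simp: minimizes_submodular_def)
  ultimately show ?thesis by simp
qed

section \<open>Bit changes\<close>

lemma fold_change_Un: "fold (change M) es (X \<union> Y) = fold (change M) es X \<union> fold (change M) es Y"
proof (induction es arbitrary: X Y)
  case (Cons e es)
  have "change M e (X \<union> Y) = change M e X \<union> change M e Y" by (cases e) auto
  then show ?case using Cons by simp
qed simp

lemma fold_change_Int: "fold (change M) es (X \<inter> Y) = fold (change M) es X \<inter> fold (change M) es Y"
proof (induction es arbitrary: X Y)
  case (Cons e es)
  have "change M e (X \<inter> Y) = change M e X \<inter> change M e Y" by (cases e) auto
  then show ?case using Cons by simp
qed simp

text \<open>Insertion and deletion of a fixed element commute with union and intersection, and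
  pulling back along such maps preserves submodularity.\<close>

lemma submodular_on_fold_change:
  assumes "submodular_on {..<n} f"
  shows "submodular_on {..<n} (\<lambda>X. f (fold (change M) es X \<inter> {..<n}))"
  unfolding submodular_on_def
proof (intro allI impI)
  fix X Y :: "nat set"
  let ?c = "\<lambda>X. fold (change M) es X \<inter> {..<n}"
  have "f (?c X) + f (?c Y) \<ge> f (?c X \<union> ?c Y) + f (?c X \<inter> ?c Y)"
    using assms[unfolded submodular_on_def, rule_format, of "?c X" "?c Y"] by simp
  moreover have "?c X \<union> ?c Y = ?c (X \<union> Y)" "?c X \<inter> ?c Y = ?c (X \<inter> Y)"
    by (auto simp: fold_change_Un fold_change_Int)
  ultimately show "f (?c X) + f (?c Y) \<ge> f (?c (X \<union> Y)) + f (?c (X \<inter> Y))" by simp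
qed

lemma fold_change_Put: "fold (change M) (map Put xs) X = X \<union> (\<lambda>x. nat (M x)) ` set xs"
  by (induction xs arbitrary: X) auto

lemma fold_change_Drop: "fold (change M) (map Drop xs) X = X - (\<lambda>x. nat (M x)) ` set xs"
  by (induction xs arbitrary: X) auto

text \<open>\<open>Call\<close> applies the changes only to arguments of the oracle; the set it
  returns is unchanged. The caller has to apply them to the cell to obtain the actual
  candidate.\<close>

fun change_cell :: "nat \<Rightarrow> bit_change list \<Rightarrow> com" where
  "change_cell s [] = Skip"
| "change_cell s (Put x # es) = Seq (Insert x s) (change_cell s es)"
| "change_cell s (Drop x # es) = Seq (Delete x s) (change_cell s es)"

lemma exec_change_cell:
  "exec n \<F> \<gamma> f q (change_cell s es) (M, S) (length es + 1) (M, S(s := fold (change M) es (S s)))"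
proof (induction s es arbitrary: S rule: change_cell.induct)
  case (1 s)
  show ?case using exec.Skip by simp
next
  case (2 s x es)
  from exec.Seq[OF exec.Insert this[of "S(s := insert (nat (M x)) (S s))"]]
  show ?case by (simp add: fun_upd_def cong: if_cong)
next
  case (3 s x es)
  from exec.Seq[OF exec.Delete this[of "S(s := S s - {nat (M x)})"]]
  show ?case by (simp add: fun_upd_def cong: if_cong)
qed

section \<open>Enumerating the intervals\<close>

text \<open>
  Cell 1 holds 1, cell 2 holds \<open>n + 1\<close>, cell 7 holds 0; cell 4 is positive once a member of the
  family has been found, and then set cell 0 is the best one so far and cell 3 its value; cells 5
  and 6 and set cell 1 belong to the current candidate.  Cell \<open>8 + i\<close> is the \<open>i\<close>-th digit: it ranges
  over \<open>{..n}\<close>, where the value \<open>n\<close> encodes the absence of an element, because all oracles ignore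
  bit \<open>n\<close>.  The first \<open>k\<close> digits are the elements of \<open>A\<close>, the last \<open>k\<close> those of \<open>B\<close>.
\<close>

definition interval_changes :: "nat \<Rightarrow> bit_change list" where
  "interval_changes k = map Put [8..<8 + k] @ map Drop [8 + k..<8 + 2 * k]"

text \<open>Sets cannot be copied, so set cells 0 and 1 are exchanged through the constants in cells
  7 and 1; the old best set is overwritten by the next call. Adding the 0 of cell 7 copies cell
  6.\<close>

definition update_best :: com where
  "update_best = Seq (Swap 7 1) (Seq (Const 4 1) (Add 3 6 7))"

text \<open>If the encoded sets overlap inside the ground set, the candidate belongs to no interval;
  the query still ensures that only members of the family are kept. The test of cell 4 avoids
  comparing with a best value that does not exist yet.\<close>

definition try_interval :: "nat \<Rightarrow> com \<Rightarrow> com" where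
  "try_interval k P =
     Seq (Call P (interval_changes k) 1)
    (Seq (change_cell 1 (interval_changes k))
    (Seq (Query 5 1)
         (Branch (Less 7 5)
            (Seq (Eval 6 1)
                 (Branch (Less 7 4) (Branch (Less 6 3) update_best Skip) update_best))
            Skip)))"

text \<open>Nested loops, the highest digit outermost. The bound \<open>n + 1\<close> is read from
  cell 2, so the program does not depend on \<open>n\<close>.\<close>

fun for_digits :: "nat \<Rightarrow> com \<Rightarrow> com" where
  "for_digits 0 c = c"
| "for_digits (Suc d) c =
     Seq (Const (8 + d) 0)
         (While (Less (8 + d) 2) (Seq (for_digits d c) (Add (8 + d) (8 + d) 1)))"

definition minimize_complement :: "nat \<Rightarrow> com \<Rightarrow> com" where
  "minimize_complement k P =
     Seq (Const 1 1) (Seq (Add 2 0 1) (for_digits (2 * k) (try_interval k P)))"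

definition digit :: "(nat \<Rightarrow> int) \<Rightarrow> nat \<Rightarrow> nat" where
  "digit M i = nat (M (8 + i))"

definition digit_interval :: "nat \<Rightarrow> nat \<Rightarrow> (nat \<Rightarrow> nat) \<Rightarrow> nat set set" where
  "digit_interval n k w = interval {..<n} (w ` {..<k}) (w ` {k..<2 * k})"

text \<open>The digit strings that need no further work. Only an interval inside the family is sure
  to yield a candidate that passes the query, whence the premise; \<open>M 4 > 0\<close> stands
  under the quantifier so that empty intervals count as covered.\<close>

definition covered ::
  "nat \<Rightarrow> nat \<Rightarrow> nat set set \<Rightarrow> (nat set \<Rightarrow> int) \<Rightarrow> (nat \<Rightarrow> int) \<Rightarrow> (nat \<Rightarrow> nat) set" where
  "covered n k \<F> f M =
     {w. digit_interval n k w \<subseteq> \<F> \<longrightarrow> (\<forall>Y \<in> digit_interval n k w. M 4 > 0 \<and> M 3 \<le> f Y)}"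

definition valid :: "nat \<Rightarrow> nat set set \<Rightarrow> (nat set \<Rightarrow> int) \<Rightarrow> state \<Rightarrow> bool" where
  "valid n \<F> f = (\<lambda>(M, S). M 1 = 1 \<and> M 2 = int n + 1 \<and> M 7 = 0 \<and>
     (M 4 > 0 \<longrightarrow> S 0 \<inter> {..<n} \<in> \<F> \<and> M 3 = f (S 0 \<inter> {..<n})))"

text \<open>Common postcondition of the body (\<open>d = 0\<close>) and of the \<open>d\<close>
  loops around it. Outer digits are kept because outer loops count with them, and covered strings
  stay covered so that successive passes add up.\<close>

definition completes ::
  "nat \<Rightarrow> nat \<Rightarrow> nat set set \<Rightarrow> (nat set \<Rightarrow> int) \<Rightarrow> nat \<Rightarrow> (nat \<Rightarrow> int) \<Rightarrow> state \<Rightarrow> bool" where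
  "completes n k \<F> f d M \<sigma> \<longleftrightarrow> valid n \<F> f \<sigma> \<and>
     (\<forall>i\<ge>d. fst \<sigma> (8 + i) = M (8 + i)) \<and>
     covered n k \<F> f M \<subseteq> covered n k \<F> f (fst \<sigma>) \<and>
     {w. (\<forall>i<d. w i \<le> n) \<and> (\<forall>i\<in>{d..<2 * k}. w i = digit M i)} \<subseteq> covered n k \<F> f (fst \<sigma>)"

lemma fold_interval_changes:
  "fold (change M) (interval_changes k) X =
     (X \<union> digit M ` {..<k}) - digit M ` {k..<2 * k}"
proof -
  have shift: "(\<lambda>x. nat (M x)) ` {8 + a..<8 + b} = digit M ` {a..<b}" for a b
  proof -
    have "{8 + a..<8 + b} = (+) 8 ` {a..<b}" by (simp only: image_add_atLeastLessThan add.commute)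
    then show ?thesis by (simp add: image_image digit_def [abs_def] del: image_add_atLeastLessThan)
  qed
  show ?thesis using shift[of 0 k] shift[of k "2 * k"]
    by (simp add: interval_changes_def fold_change_Put fold_change_Drop atLeast0LessThan)
qed

lemma covered_cong:
  assumes "\<And>i. i < 2 * k \<Longrightarrow> w i = v i"
  shows "w \<in> covered n k \<F> f M \<longleftrightarrow> v \<in> covered n k \<F> f M"
proof -
  have "w ` {..<k} = v ` {..<k}" "w ` {k..<2 * k} = v ` {k..<2 * k}"
    using assms by (auto intro!: image_cong)
  then show ?thesis by (simp add: covered_def digit_interval_def)
qed

lemma completes_zeroI:
  assumes "valid n \<F> f \<sigma>" "\<And>i. fst \<sigma> (8 + i) = M (8 + i)"
    and "covered n k \<F> f M \<subseteq> covered n k \<F> f (fst \<sigma>)" "digit M \<in> covered n k \<F> f (fst \<sigma>)"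
  shows "completes n k \<F> f 0 M \<sigma>"
proof -
  have "w \<in> covered n k \<F> f (fst \<sigma>)" if "\<forall>i\<in>{0..<2 * k}. w i = digit M i" for w
    using covered_cong[of k w "digit M"] that assms(4) by simp
  then show ?thesis unfolding completes_def using assms by blast
qed

section \<open>Processing one candidate interval\<close>

lemma terminates_update_best:
  assumes "valid n \<F> f (M, S)" "S 1 \<inter> {..<n} \<in> \<F>" "M 6 = f (S 1 \<inter> {..<n})"
    and better: "M 4 > 0 \<Longrightarrow> M 6 < M 3"
    and cov: "\<And>Y. digit_interval n k (digit M) \<subseteq> \<F> \<Longrightarrow> Y \<in> digit_interval n k (digit M) \<Longrightarrow>
                M 6 \<le> f Y"
  shows "terminates n \<F> \<gamma> f 1 update_best (M, S) (1 + (1 + 1)) (completes n k \<F> f 0 M)"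
proof -
  define S' where "S' = S(0 := S 1, 1 := S 0)"
  let ?N = "M(4 := 1, 3 := (M(4 := 1)) 6 + (M(4 := 1)) 7)"
  have N3: "?N 3 = f (S 1 \<inter> {..<n})" using assms(1,3) by (simp add: valid_def)
  have "covered n k \<F> f M \<subseteq> covered n k \<F> f ?N"
    using better assms(3) N3 by (force simp: covered_def)
  moreover have "digit M \<in> covered n k \<F> f ?N"
    using cov assms(3) N3 by (simp add: covered_def)
  moreover have "valid n \<F> f (?N, S')"
    using assms(1,2) N3 by (simp add: valid_def S'_def)
  ultimately have "completes n k \<F> f 0 M (?N, S')"
    by (intro completes_zeroI) simp_all
  then have "terminates n \<F> \<gamma> f 1 (Add 3 6 7) (M(4 := 1), S') 1 (completes n k \<F> f 0 M)"
    by (rule terminates_atomic)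
  then show ?thesis
    unfolding update_best_def
    by (intro terminates_Seq_atomic) (use assms(1) in \<open>simp_all add: valid_def S'_def\<close>)
qed

text \<open>Each of the \<open>2 * k\<close> bit changes is made and undone, so an evaluation inside
  the call costs \<open>4 * k + 1\<close>; applying the changes to the result costs
  \<open>2 * k + 1\<close>.\<close>

lemma terminates_try_interval:
  assumes P: "minimizes_submodular P \<tau>" and f: "submodular_on {..<n} f"
    and valid: "valid n \<F> f (M, S)"
  shows "terminates n \<F> \<gamma> f 1 (try_interval k P) (M, S)
           ((4 * k + 1) * \<tau> n + \<gamma> + 2 * k + 9) (completes n k \<F> f 0 M)"
proof -
  let ?es = "interval_changes k"
  let ?V = "{..<n}"
  let ?I = "digit_interval n k (digit M)"
  define g where "g = (\<lambda>X. f (fold (change M) ?es X \<inter> ?V))"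
  have len: "length ?es = 2 * k" by (simp add: interval_changes_def)
  have call: "terminates n \<F> \<gamma> f 1 (Call P ?es 1) (M, S) ((4 * k + 1) * \<tau> n + 1)
      (\<lambda>\<sigma>. \<exists>Y. is_minimizer g (Pow ?V) Y \<and> \<sigma> = (M, S(1 := Y)))"
    using terminates_minimization[OF P submodular_on_fold_change[OF f, of M ?es],
        of "4 * k + 1" \<F> \<gamma>]
    by (intro terminates_Call) (auto simp: g_def len elim: terminates_mono)
  have rest: "terminates n \<F> \<gamma> f 1
      (Seq (change_cell 1 ?es)
      (Seq (Query 5 1)
         (Branch (Less 7 5)
            (Seq (Eval 6 1)
                 (Branch (Less 7 4) (Branch (Less 6 3) update_best Skip) update_best))
            Skip))) (M, S(1 := Y)) ((2 * k + 1) + (\<gamma> + ((1 + (3 + 1 + 1)) + 1))) (completes n k \<F> f 0 M)"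
    if Y: "is_minimizer g (Pow ?V) Y" for Y
  proof -
    define Z where "Z = fold (change M) ?es Y"
    define S' where "S' = S(1 := Z)"
    have Z: "Z = (Y \<union> digit M ` {..<k}) - digit M ` {k..<2 * k}"
      by (simp add: Z_def fold_interval_changes)
    \<comment> \<open>On the interval the changes do nothing, so \<open>g\<close> agrees with
      \<open>f\<close> there and a global minimizer of \<open>g\<close> is at least as good as every
      set of the interval.\<close>
    have fix_I: "fold (change M) ?es X \<inter> ?V = X" if "X \<in> ?I" for X
      using that by (auto simp: fold_interval_changes digit_interval_def interval_def)
    have Z_min: "f (Z \<inter> ?V) \<le> f X" if "X \<in> ?I" for X
    proof -
      have "X \<in> Pow ?V" using that by (auto simp: digit_interval_def interval_def)
      then have "g Y \<le> g X" using Y by (auto simp: is_minimizer_def)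
      then show ?thesis using fix_I[OF that] by (simp add: g_def Z_def)
    qed
    \<comment> \<open>A nonempty interval forces the two digit sets to be disjoint inside the ground
      set, so the later deletions undo no insertion.\<close>
    have Z_in: "Z \<inter> ?V \<in> ?I" if "X \<in> ?I" for X
      using that by (auto simp: Z digit_interval_def interval_def)
    have change: "terminates n \<F> \<gamma> f 1 (change_cell 1 ?es) (M, S(1 := Y)) (2 * k + 1)
        (\<lambda>\<sigma>. \<sigma> = (M, S'))"
      using exec_change_cell[of n \<F> \<gamma> f 1 1 ?es M "S(1 := Y)"]
      unfolding terminates_def len S'_def Z_def by auto
    define a :: int where "a = (if Z \<inter> ?V \<in> \<F> then 1 else 0)"
    define M5 where "M5 = M(5 := a)"
    define M6 where "M6 = M5(6 := f (Z \<inter> ?V))"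
    have valid6: "valid n \<F> f (M6, S')" and valid5: "valid n \<F> f (M5, S')"
      using valid by (auto simp: valid_def M6_def M5_def S'_def)
    have dig: "digit M6 = digit M" by (simp add: digit_def M6_def M5_def fun_eq_iff)
    \<comment> \<open>Cells 5 and 6 are neither digits nor the cells 3 and 4 read by
      \<open>covered\<close>.\<close>
    have comp6: "completes n k \<F> f 0 M6 = completes n k \<F> f 0 M"
      by (simp add: completes_def digit_def covered_def M6_def M5_def fun_eq_iff)
    have inner: "terminates n \<F> \<gamma> f 1
         (Branch (Less 7 4) (Branch (Less 6 3) update_best Skip) update_best)
         (M6, S') (3 + 1 + 1) (completes n k \<F> f 0 M)" if "Z \<inter> ?V \<in> \<F>"
    proof -
      have upd: "terminates n \<F> \<gamma> f 1 update_best (M6, S') 3 (completes n k \<F> f 0 M)"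
        if "M6 4 > 0 \<Longrightarrow> M6 6 < M6 3"
        using terminates_update_best[OF valid6, of k \<gamma>] that \<open>Z \<inter> ?V \<in> \<F>\<close> Z_min
        unfolding comp6 dig by (simp add: S'_def M6_def numeral_3_eq_3)
      have skip: "terminates n \<F> \<gamma> f 1 Skip (M6, S') 3 (completes n k \<F> f 0 M)"
        if "M6 4 > 0" "\<not> M6 6 < M6 3"
      proof -
        have "completes n k \<F> f 0 M (M6, S')"
          using valid6 that Z_min
          by (intro completes_zeroI) (force simp: covered_def M6_def M5_def)+
        then show ?thesis
          by (intro terminates_mono[OF terminates_atomic(1)[where Q = "completes n k \<F> f 0 M"]]) auto
      qed
      have M7: "M6 7 = 0" using valid6 by (simp add: valid_def)
      show ?thesis
        by (intro terminates_Branch)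
          (use upd skip M7 in \<open>auto elim!: terminates_mono\<close>)
    qed
    show ?thesis
    proof (rule terminates_Seq[OF change], erule ssubst, rule terminates_Seq_atomic)
      show "M5 = M(5 := if S' 1 \<inter> ?V \<in> \<F> then 1 else 0)"
        by (simp add: M5_def a_def S'_def)
      show "terminates n \<F> \<gamma> f 1 (Branch (Less 7 5)
            (Seq (Eval 6 1)
                 (Branch (Less 7 4) (Branch (Less 6 3) update_best Skip) update_best))
            Skip) (M5, S') ((1 + (3 + 1 + 1)) + 1) (completes n k \<F> f 0 M)"
      proof (rule terminates_Branch)
        assume "holds (Less 7 5) (M5, S')"
        then have "Z \<inter> ?V \<in> \<F>"
          using valid5 by (auto simp: valid_def M5_def a_def split: if_splits)
        from inner[OF this]
        show "terminates n \<F> \<gamma> f 1 (Seq (Eval 6 1)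
                 (Branch (Less 7 4) (Branch (Less 6 3) update_best Skip) update_best))
            (M5, S') (1 + (3 + 1 + 1)) (completes n k \<F> f 0 M)"
          by (rule terminates_Seq_atomic) (simp_all add: M6_def S'_def)
      next
        assume "\<not> holds (Less 7 5) (M5, S')"
        then have "Z \<inter> ?V \<notin> \<F>"
          using valid5 by (auto simp: valid_def M5_def a_def)
        \<comment> \<open>After a negative answer the interval is either empty or contains a set
          outside the family.\<close>
        then have "digit M \<in> covered n k \<F> f M5"
          using Z_in by (auto simp: covered_def)
        then have "completes n k \<F> f 0 M (M5, S')"
          using valid5 by (intro completes_zeroI) (auto simp: covered_def M5_def)
        then show "terminates n \<F> \<gamma> f 1 Skip (M5, S') (1 + (3 + 1 + 1)) (completes n k \<F> f 0 M)"
          by (intro terminates_mono[OF terminates_atomic(1)[where Q = "completes n k \<F> f 0 M"]]) auto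
      qed
    qed (rule refl)
  qed
  have "terminates n \<F> \<gamma> f 1 (try_interval k P) (M, S)
     (((4 * k + 1) * \<tau> n + 1) + ((2 * k + 1) + (\<gamma> + ((1 + (3 + 1 + 1)) + 1)))) (completes n k \<F> f 0 M)"
    unfolding try_interval_def by (rule terminates_Seq[OF call]) (use rest in auto)
  then show ?thesis by (rule terminates_mono) auto
qed

section \<open>The nested loops over the digits\<close>

text \<open>Per level, the initialization, the increments and the tests together cost at most 4
  units per pass, which gives the summand \<open>4 * d\<close>.\<close>

lemma terminates_for_digits:
  assumes body: "\<And>M S. valid n \<F> f (M, S) \<Longrightarrow>
      terminates n \<F> \<gamma> f q c (M, S) T (completes n k \<F> f 0 M)"
    and "d \<le> 2 * k" "valid n \<F> f (M, S)"
  shows "terminates n \<F> \<gamma> f q (for_digits d c) (M, S) ((n + 1) ^ d * (T + 4 * d))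
           (completes n k \<F> f d M)"
  using assms(2,3)
proof (induction d arbitrary: M S)
  case 0
  then show ?case using body by simp
next
  case (Suc d)
  define Td where "Td = (n + 1) ^ d * (T + 4 * d)"
  \<comment> \<open>After \<open>j\<close> passes the strings with \<open>w d < j\<close> are
    covered; at \<open>j = n + 1\<close> this is the whole range of the digit, including the padding
    value \<open>n\<close>.\<close>
  define Inv where "Inv j \<sigma> \<longleftrightarrow> valid n \<F> f \<sigma> \<and> fst \<sigma> (8 + d) = int j \<and>
     (\<forall>i\<ge>Suc d. fst \<sigma> (8 + i) = M (8 + i)) \<and>
     covered n k \<F> f M \<subseteq> covered n k \<F> f (fst \<sigma>) \<and>
     {w. (\<forall>i<d. w i \<le> n) \<and> w d < j \<and> (\<forall>i\<in>{Suc d..<2 * k}. w i = digit M i)}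
       \<subseteq> covered n k \<F> f (fst \<sigma>)" for j \<sigma>
  have init: "Inv 0 (M(8 + d := 0), S)"
    using Suc.prems by (auto simp: Inv_def valid_def covered_def)
  have step: "holds (Less (8 + d) 2) \<sigma> \<and>
      terminates n \<F> \<gamma> f q (Seq (for_digits d c) (Add (8 + d) (8 + d) 1)) \<sigma> (Td + 1) (Inv (Suc j))"
    if "j < n + 1" "Inv j \<sigma>" for j \<sigma>
  proof -
    obtain M' S' where \<sigma>: "\<sigma> = (M', S')" by (cases \<sigma>)
    have valid: "valid n \<F> f (M', S')" and dig: "M' (8 + d) = int j"
      using that by (auto simp: Inv_def \<sigma>)
    have "terminates n \<F> \<gamma> f q (Add (8 + d) (8 + d) 1) \<rho> 1 (Inv (Suc j))"
      if comp: "completes n k \<F> f d M' \<rho>" for \<rho>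
    proof -
      obtain M'' S'' where \<rho>: "\<rho> = (M'', S'')" by (cases \<rho>)
      let ?N = "M''(8 + d := M'' (8 + d) + M'' 1)"
      have valid'': "valid n \<F> f (M'', S'')"
        and keep: "\<And>i. i \<ge> d \<Longrightarrow> M'' (8 + i) = M' (8 + i)"
        and cov: "covered n k \<F> f M' \<subseteq> covered n k \<F> f M''"
        and new: "{w. (\<forall>i<d. w i \<le> n) \<and> (\<forall>i\<in>{d..<2 * k}. w i = digit M' i)} \<subseteq> covered n k \<F> f M''"
        using comp by (auto simp: completes_def \<rho>)
      have covN: "covered n k \<F> f ?N = covered n k \<F> f M''" by (simp add: covered_def)
      have digM: "digit M' i = digit M i" if "i \<ge> Suc d" for i
        using \<open>Inv j \<sigma>\<close> that by (auto simp: Inv_def \<sigma> digit_def)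
      have "w \<in> covered n k \<F> f M''"
        if w: "\<forall>i<d. w i \<le> n" "w d < Suc j" "\<forall>i\<in>{Suc d..<2 * k}. w i = digit M i" for w
      \<comment> \<open>Digit value \<open>j\<close> is handled by the current pass, smaller values
        by earlier passes.\<close>
      proof (cases "w d = j")
        case True
        have "w i = digit M' i" if "i \<in> {d..<2 * k}" for i
        proof (cases "i = d")
          case True
          then show ?thesis using \<open>w d = j\<close> dig by (simp add: digit_def)
        next
          case False
          then show ?thesis using w(3) digM that by auto
        qed
        then show ?thesis using new w(1) by blast
      next
        case False
        then have "w \<in> covered n k \<F> f M'" using \<open>Inv j \<sigma>\<close> w by (auto simp: Inv_def \<sigma>)
        then show ?thesis using cov by blast
      qed
      moreover have "valid n \<F> f (?N, S'')" using valid'' by (auto simp: valid_def)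
      moreover have "?N (8 + d) = int (Suc j)"
        using keep[of d] dig valid'' by (simp add: valid_def)
      moreover have "?N (8 + i) = M (8 + i)" if "i \<ge> Suc d" for i
        using keep[of i] that \<open>Inv j \<sigma>\<close> by (auto simp: Inv_def \<sigma>)
      moreover have "covered n k \<F> f M \<subseteq> covered n k \<F> f M''"
        using cov \<open>Inv j \<sigma>\<close> by (auto simp: Inv_def \<sigma>)
      ultimately have "Inv (Suc j) (?N, S'')" unfolding Inv_def fst_conv covN by blast
      then show ?thesis unfolding \<rho> by (rule terminates_atomic)
    qed
    then have "terminates n \<F> \<gamma> f q (Seq (for_digits d c) (Add (8 + d) (8 + d) 1)) \<sigma> (Td + 1) (Inv (Suc j))"
      using Suc.IH[OF _ valid] Suc.prems unfolding Td_def \<sigma>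
      by (intro terminates_Seq[where R = "completes n k \<F> f d M'"]) auto
    moreover have "holds (Less (8 + d) 2) \<sigma>"
      using valid dig \<open>j < n + 1\<close> by (simp add: \<sigma> valid_def)
    ultimately show ?thesis by blast
  qed
  have exit: "\<not> holds (Less (8 + d) 2) \<sigma>" if "Inv (n + 1) \<sigma>" for \<sigma>
    using that by (cases \<sigma>) (auto simp: Inv_def valid_def)
  have post: "completes n k \<F> f (Suc d) M \<sigma>" if "Inv (n + 1) \<sigma>" for \<sigma>
    using that by (auto simp: Inv_def completes_def subset_iff less_Suc_eq_le)
  have "terminates n \<F> \<gamma> f q (for_digits (Suc d) c) (M, S)
      (1 + ((n + 1) * ((Td + 1) + 1) + 1)) (Inv (n + 1))"
    unfolding for_digits.simps
    by (intro terminates_Seq_atomic(1)[OF _ refl refl] terminates_While[where Inv = Inv])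
      (use step exit init in blast)+
  moreover have "1 + ((n + 1) * ((Td + 1) + 1) + 1) \<le> (n + 1) ^ Suc d * (T + 4 * Suc d)"
  proof -
    have "1 + ((n + 1) * ((Td + 1) + 1) + 1) \<le> (n + 1) * (Td + 4)" by (simp add: algebra_simps)
    also have "Td + 4 \<le> (n + 1) ^ d * (T + 4 * Suc d)"
      using one_le_power[of "n + 1" d] by (simp add: Td_def algebra_simps)
    finally show ?thesis by (simp only: power_Suc mult.assoc mult_le_mono2)
  qed
  ultimately show ?case using post by (rule terminates_mono)
qed

section \<open>Completeness of the enumeration and the time bound\<close>

lemma complement_hierarchical_digits:
  assumes "complement_hierarchical k {..<n} \<F>" "Y \<in> \<F>"
  obtains w where "\<forall>i. w i \<le> n" "Y \<in> digit_interval n k w" "digit_interval n k w \<subseteq> \<F>"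
proof -
  let ?V = "{..<n}"
  have Y: "Y \<subseteq> ?V" "Y \<notin> Pow ?V - \<F>" and hl: "hierarchical_lattice k ?V (Pow ?V - \<F>)"
    using assms by (auto simp: complement_hierarchical_def)
  obtain A B where AB: "A \<subseteq> Y" "B \<subseteq> ?V - Y" "card A \<le> k" "card B \<le> k"
    and avoid: "interval ?V A B \<inter> (Pow ?V - \<F>) = {}"
    using hierarchical_lattice_separation[OF finite_lessThan hl Y] .
  obtain a where a: "\<And>i. a i \<le> n" "a ` {..<k} \<inter> ?V = A"
    using ex_enumeration_with_padding[of A n k] AB Y by blast
  obtain b where b: "\<And>i. b i \<le> n" "b ` {..<k} \<inter> ?V = B"
    using ex_enumeration_with_padding[of B n k] AB by blast
  define w where "w i = (if i < k then a i else b (i - k))" for i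
  have "w ` {..<k} = a ` {..<k}" by (auto simp: w_def)
  moreover have "w ` {k..<2 * k} = b ` {..<k}"
  proof -
    have "w ` {k..<2 * k} = w ` ((+) k ` {0..<k})" by (simp add: mult_2)
    also have "\<dots> = b ` {..<k}" unfolding image_image by (auto simp: w_def)
    finally show ?thesis .
  qed
  moreover have "interval ?V A' B' = interval ?V (A' \<inter> ?V) (B' \<inter> ?V)" for A' B'
    by (auto simp: interval_def)
  ultimately have "digit_interval n k w = interval ?V A B"
    using a(2) b(2) by (metis digit_interval_def)
  moreover have "Y \<in> interval ?V A B" using AB Y by (auto simp: interval_def)
  moreover have "interval ?V A B \<subseteq> \<F>" using avoid by (auto simp: interval_def)
  moreover have "w i \<le> n" for i using a b by (simp add: w_def)
  ultimately show thesis using that by metis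
qed

lemma terminates_minimize_complement:
  assumes "minimizes_submodular P \<tau>" "submodular_on {..<n} f" "complement_hierarchical k {..<n} \<F>"
  shows "terminates n \<F> \<gamma> f 1 (minimize_complement k P) (start n)
     (2 + (n + 1) ^ (2 * k) * ((4 * k + 1) * \<tau> n + \<gamma> + 10 * k + 9))
     (\<lambda>\<sigma>. \<F> \<noteq> {} \<longrightarrow> is_minimizer f \<F> (result n \<sigma>))"
proof -
  define M :: "nat \<Rightarrow> int" where "M = ((\<lambda>_. 0)(0 := int n, 1 := 1, 2 := int n + 1))"
  define S :: "nat \<Rightarrow> nat set" where "S = (\<lambda>_. {})"
  let ?T = "(4 * k + 1) * \<tau> n + \<gamma> + 2 * k + 9"
  have valid: "valid n \<F> f (M, S)" by (simp add: valid_def M_def)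
  have "terminates n \<F> \<gamma> f 1 (for_digits (2 * k) (try_interval k P)) (M, S)
      ((n + 1) ^ (2 * k) * (?T + 4 * (2 * k))) (completes n k \<F> f (2 * k) M)"
    by (rule terminates_for_digits[OF terminates_try_interval[OF assms(1,2)] order_refl valid])
  moreover have "\<F> \<noteq> {} \<longrightarrow> is_minimizer f \<F> (result n \<sigma>)"
    if "completes n k \<F> f (2 * k) M \<sigma>" for \<sigma>
  proof
    obtain N R where \<sigma>: "\<sigma> = (N, R)" by (cases \<sigma>)
    \<comment> \<open>With all \<open>2 * k\<close> loops finished no outer digit is left to
      constrain a string, so the one whose interval contains \<open>Y\<close> is covered.\<close>
    have best: "N 4 > 0 \<and> N 3 \<le> f Y" if Y: "Y \<in> \<F>" for Y
    proof -
      obtain w where "\<forall>i. w i \<le> n" "Y \<in> digit_interval n k w" "digit_interval n k w \<subseteq> \<F>"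
        by (rule complement_hierarchical_digits[OF assms(3) Y])
      moreover from this(1) have "w \<in> covered n k \<F> f N"
        using that \<open>completes n k \<F> f (2 * k) M \<sigma>\<close> by (auto simp: completes_def \<sigma>)
      ultimately show ?thesis by (auto simp: covered_def)
    qed
    assume "\<F> \<noteq> {}"
    then have "N 4 > 0" using best by blast
    moreover have "valid n \<F> f (N, R)" using that by (simp add: completes_def \<sigma>)
    ultimately show "is_minimizer f \<F> (result n \<sigma>)"
      using best by (auto simp: is_minimizer_def result_def \<sigma> valid_def)
  qed
  ultimately have "terminates n \<F> \<gamma> f 1 (for_digits (2 * k) (try_interval k P)) (M, S)
      ((n + 1) ^ (2 * k) * ((4 * k + 1) * \<tau> n + \<gamma> + 10 * k + 9))
      (\<lambda>\<sigma>. \<F> \<noteq> {} \<longrightarrow> is_minimizer f \<F> (result n \<sigma>))"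
    by (elim terminates_mono) simp_all
  then have "terminates n \<F> \<gamma> f 1 (minimize_complement k P) (start n)
     (1 + (1 + (n + 1) ^ (2 * k) * ((4 * k + 1) * \<tau> n + \<gamma> + 10 * k + 9)))
     (\<lambda>\<sigma>. \<F> \<noteq> {} \<longrightarrow> is_minimizer f \<F> (result n \<sigma>))"
    unfolding minimize_complement_def start_def
    by (intro terminates_Seq_atomic(1)[OF terminates_Seq_atomic(2)])
      (auto simp: M_def S_def)
  then show ?thesis by (rule terminates_mono) auto
qed

theorem theorem2p3:
  fixes k :: nat
  assumes "k \<ge> 1"
  shows "\<exists>C :: nat. \<forall>P \<tau>. minimizes_submodular P \<tau> \<longrightarrow>
    (\<exists>Q. \<forall>n \<F> f \<gamma>.
       complement_hierarchical k {..<n} \<F> \<longrightarrow> submodular_on {..<n} f \<longrightarrow>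
       (\<exists>t \<sigma>. exec n \<F> \<gamma> f 1 Q (start n) t \<sigma> \<and>
              (\<F> \<noteq> {} \<longrightarrow> is_minimizer f \<F> (result n \<sigma>)) \<and>
              (n \<ge> 1 \<longrightarrow> t \<le> C * n ^ (2 * k) * (\<tau> n + \<gamma>))))"
\<comment> \<open>For \<open>n \<ge> 1\<close>, \<open>n + 1 \<le> 2 * n\<close> yields the power of
  2. The factor \<open>14 * k + 12\<close> is \<open>4 * k + 1\<close> from the calls plus
  \<open>10 * k + 11\<close>, the additive overhead including the 2 initial steps, absorbed by
  \<open>\<tau> n \<ge> 1\<close>.\<close>
proof (intro exI[of _ "2 ^ (2 * k) * (14 * k + 12)"] allI impI, goal_cases)
  case (1 P \<tau>)
  show ?case
  proof (intro exI[of _ "minimize_complement k P"] allI impI, goal_cases)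
    case (1 n \<F> f \<gamma>)
    let ?T = "(4 * k + 1) * \<tau> n + \<gamma> + 10 * k + 9"
    obtain t \<sigma> where t: "exec n \<F> \<gamma> f 1 (minimize_complement k P) (start n) t \<sigma>"
      "\<F> \<noteq> {} \<longrightarrow> is_minimizer f \<F> (result n \<sigma>)" "t \<le> 2 + (n + 1) ^ (2 * k) * ?T"
      using terminates_minimize_complement[OF \<open>minimizes_submodular P \<tau>\<close> 1(2,1), of \<gamma>]
      unfolding terminates_def by blast
    have "t \<le> 2 ^ (2 * k) * (14 * k + 12) * n ^ (2 * k) * (\<tau> n + \<gamma>)" if "n \<ge> 1"
    proof -
      have "(2 :: nat) \<le> (n + 1) ^ (2 * k) * 2" using one_le_power[of "n + 1" "2 * k"] by simp
      then have "t \<le> (n + 1) ^ (2 * k) * (?T + 2)"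
        using t(3) unfolding distrib_left[of _ ?T 2] by linarith
      also have "\<dots> \<le> (2 * n) ^ (2 * k) * ((14 * k + 12) * (\<tau> n + \<gamma>))"
      proof (rule mult_le_mono)
        show "(n + 1) ^ (2 * k) \<le> (2 * n) ^ (2 * k)" using that by (intro power_mono) auto
        have "10 * k + 11 \<le> (10 * k + 11) * \<tau> n"
          using minimization_time_pos[OF \<open>minimizes_submodular P \<tau>\<close>, of n] by simp
        moreover have "\<gamma> \<le> (14 * k + 12) * \<gamma>" by simp
        ultimately show "?T + 2 \<le> (14 * k + 12) * (\<tau> n + \<gamma>)" by (simp add: algebra_simps)
      qed
      finally show ?thesis by (simp add: power_mult_distrib algebra_simps)
    qed
    with t show ?case by blast
  qed
qed

end
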